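(* For $-3\le r\le s\le 3$ and all $a,b>0$, $$S_*(I_{r,s})=a^{\frac{b}{a+b}}b^{\frac{a}{a+b}}\le I_{-3,-3}(a,b)\le I_{r,s}(a,b)\le I_{3,3}(a,b)\le a^{\frac{a}{a+b}}b^{\frac{b}{a+b}}=S^*(I_{r,s}),$$ where the given constants $-3$ and $3$ are best possible: $s=3$ is the largest real $s$ such that $I_{s,s}(a,b)\le a^{\frac{a}{a+b}}b^{\frac{b}{a+b}}$ for all $a,b>0$, and $s=-3$ is the smallest real $s$ such that $a^{\frac{b}{a+b}}b^{\frac{a}{a+b}}\le I_{s,s}(a,b)$ for all $a,b>0$. Here the outer equalities say that $a^{\frac{b}{a+b}}b^{\frac{a}{a+b}}$ is a left cancelling mean, and $a^{\frac{a}{a+b}}b^{\frac{b}{a+b}}$ a right cancelling mean, for the class of Stolarsky means $\{I_{r,s}\}$.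
   Context: A mean is a map $M:\mathbb R_+\times\mathbb R_+\to\mathbb R_+$ (with $\mathbb R_+=(0,\infty)$) such that $\min(a,b)\le M(a,b)\le\max(a,b)$ for all $a,b>0$. $\Omega$ is the class of means that are symmetric in $a,b$, reflexive ($M(a,a)=a$) and homogeneous of order one. $M\le N$ means $M(a,b)\le N(a,b)$ for all $a,b>0$. A family $\Delta$ of means is ordered if for any $M,N\in\Delta$ we have $M\le N$ or $N\le M$. A mean $S^*(\Delta)$ is a right cancelling mean for an ordered class of means $\Delta\subset\Omega$ if there exists $M\in\Delta$ such that $S^*(a,b)\ge M(a,b)$, but there is no mean $N\in\Delta$ such that the inequality $N(a,b)\ge S^*(a,b)$ holds for each $a,b\in\mathbb R_+$. The left cancelling mean $S_*(\Delta)$ is defined analogously: there exists $M\in\Delta$ such that $S_*(a,b)\le M(a,b)$, but there is no $N\in\Delta$ such that $N(a,b)\le S_*(a,b)$ holds for each $a,b\in\mathbb R_+$. Cancelling means are not unique. The Stolarsky means $I_{r,s}$, $r,s\in\mathbb R$, are defined for $x,y>0$, $x\ne y$, by $$I_{r,s}(x,y)=\begin{cases}\Bigl(\dfrac{r(x^s-y^s)}{s(x^r-y^r)}\Bigr)^{1/(s-r)},& rs(r-s)\ne0,\\[2mm] \exp\Bigl(-\dfrac1s+\dfrac{x^s\log x-y^s\log y}{x^s-y^s}\Bigr),& r=s\ne0,\\[2mm] \Bigl(\dfrac{x^s-y^s}{s(\log x-\log y)}\Bigr)^{1/s},& s\ne0,\ r=0,\\[2mm] \sqrt{xy},& r=s=0,\end{cases}$$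 with $I_{r,s}=I_{s,r}$ (symmetry in the parameters, which covers $s=0$, $r\ne0$) and $I_{r,s}(x,x)=x$.
   Formalization: Cancelling means are defined for ordered classes, but the class of all Stolarsky means is not ordered (I_{1,1} and I_{0,2.1} are incomparable); the defining conditions of left and right cancelling means are therefore applied to this class without requiring that it be ordered. *)

theory Defs
  imports Complex_Main
begin

text \<open>
  Means are functions on \<open>(0,\<infinity>) \<times> (0,\<infinity>)\<close>. They are represented by total functions on the
  reals, and every condition is restricted to positive arguments.
\<close>

definition is_mean :: "(real \<Rightarrow> real \<Rightarrow> real) \<Rightarrow> bool" where
  "is_mean M \<longleftrightarrow> (\<forall>a>0. \<forall>b>0. min a b \<le> M a b \<and> M a b \<le> max a b)"

definition Omega_means :: "(real \<Rightarrow> real \<Rightarrow> real) set" where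
  "Omega_means = {M. is_mean M \<and>
     (\<forall>a>0. \<forall>b>0. M a b = M b a) \<and>
     (\<forall>a>0. M a a = a) \<and>
     (\<forall>t>0. \<forall>a>0. \<forall>b>0. M (t * a) (t * b) = t * M a b)}"

definition mean_le :: "(real \<Rightarrow> real \<Rightarrow> real) \<Rightarrow> (real \<Rightarrow> real \<Rightarrow> real) \<Rightarrow> bool" where
  "mean_le M N \<longleftrightarrow> (\<forall>a>0. \<forall>b>0. M a b \<le> N a b)"

text \<open>
  Cancelling means are usually introduced for classes that are totally ordered by \<open>mean_le\<close>.
  Orderedness is not a conjunct below, because the full two-parameter Stolarsky class is not
  totally ordered: the members with parameters \<open>(1, 1)\<close> and \<open>(0, 2.1)\<close> are incomparable.
\<close>

definition right_cancelling_mean ::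
  "(real \<Rightarrow> real \<Rightarrow> real) set \<Rightarrow> (real \<Rightarrow> real \<Rightarrow> real) \<Rightarrow> bool" where
  "right_cancelling_mean \<Delta> S \<longleftrightarrow> \<Delta> \<subseteq> Omega_means \<and> is_mean S \<and>
     (\<exists>M\<in>\<Delta>. mean_le M S) \<and> \<not> (\<exists>N\<in>\<Delta>. mean_le S N)"

definition left_cancelling_mean ::
  "(real \<Rightarrow> real \<Rightarrow> real) set \<Rightarrow> (real \<Rightarrow> real \<Rightarrow> real) \<Rightarrow> bool" where
  "left_cancelling_mean \<Delta> S \<longleftrightarrow> \<Delta> \<subseteq> Omega_means \<and> is_mean S \<and>
     (\<exists>M\<in>\<Delta>. mean_le S M) \<and> \<not> (\<exists>N\<in>\<Delta>. mean_le N S)"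

text \<open>
  For \<open>x, y > 0\<close> with \<open>x \<noteq> y\<close>, all bases of \<open>powr\<close> below are positive, so \<open>powr\<close> is the
  ordinary real power there.
\<close>

definition stolarsky :: "real \<Rightarrow> real \<Rightarrow> real \<Rightarrow> real \<Rightarrow> real" where
  "stolarsky r s x y =
    (if x = y then x
     else if r * s * (r - s) \<noteq> 0 then
       ((r * (x powr s - y powr s)) / (s * (x powr r - y powr r))) powr (1 / (s - r))
     else if r = s \<and> s \<noteq> 0 then
       exp (- (1 / s) + (x powr s * ln x - y powr s * ln y) / (x powr s - y powr s))
     else if s \<noteq> 0 \<and> r = 0 then
       ((x powr s - y powr s) / (s * (ln x - ln y))) powr (1 / s)
     else if r \<noteq> 0 \<and> s = 0 then
       ((x powr r - y powr r) / (r * (ln x - ln y))) powr (1 / r)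
     else sqrt (x * y))"

definition stolarsky_class :: "(real \<Rightarrow> real \<Rightarrow> real) set" where
  "stolarsky_class = {stolarsky r s | r s. True}"

definition lower_mean :: "real \<Rightarrow> real \<Rightarrow> real" where
  "lower_mean a b = a powr (b / (a + b)) * b powr (a / (a + b))"

definition upper_mean :: "real \<Rightarrow> real \<Rightarrow> real" where
  "upper_mean a b = a powr (a / (a + b)) * b powr (b / (a + b))"

end

theory Submission
  imports Defs "HOL-Real_Asymp.Real_Asymp"
begin

text \<open>
  Put \<open>a = g e\<^sup>t\<close>, \<open>b = g e\<^sup>-\<^sup>t\<close>. With \<open>\<Lambda>(u) = ln (sinh u / u)\<close>
  and \<open>K = \<Lambda>' = coth u - 1/u\<close>, the Stolarsky mean is \<open>g exp D\<close>, where \<open>D\<close> is the difference quotient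
  of \<open>p \<mapsto> \<Lambda>(p t)\<close> between \<open>r\<close> and \<open>s\<close>, and \<open>D = t K(s t)\<close> if \<open>r = s\<close>; the outer means are
  \<open>g exp (\<plusminus> t tanh t)\<close>. By the mean value theorem \<open>D = t K(\<xi> t)\<close> for some \<open>\<xi>\<close> between \<open>r\<close> and \<open>s\<close>,
  and this is increasing in \<open>\<xi>\<close>. The bound \<open>K(3 t) \<le> tanh t\<close> is \<open>3 v \<le> 2 sinh v + tanh v\<close> with \<open>v = 2 t\<close>.
  The constant \<open>3\<close> is read off from \<open>K(s t) / t \<rightarrow> s/3\<close> as \<open>t \<rightarrow> 0\<close>. The outer means are cancelling because,
  as \<open>t \<rightarrow> \<infinity>\<close>, \<open>1 - tanh t\<close> decays exponentially but \<open>1 - K(s t)\<close> only like \<open>1/(s t)\<close>.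
\<close>

text \<open>
  Since \<open>x / 0 = 0\<close> and \<open>ln 0 = 0\<close>, \<open>log_sinhc\<close> and \<open>langevin\<close> take at \<open>0\<close> the value of their continuous extension.
\<close>

definition log_sinhc :: "real \<Rightarrow> real" where
  "log_sinhc u = ln (sinh u / u)"

definition langevin :: "real \<Rightarrow> real" where
  "langevin u = cosh u / sinh u - 1 / u"

text \<open>Since \<open>log_sinhc 0 = 0\<close>, the off-diagonal quotient also covers the cases
  where \<open>r\<close> or \<open>s\<close> vanishes, so two cases replace the five of
  \<open>stolarsky\<close>.\<close>

definition stolarsky_exponent :: "real \<Rightarrow> real \<Rightarrow> real \<Rightarrow> real" where
  "stolarsky_exponent r s t =
    (if r = s then t * langevin (s * t)
     else (log_sinhc (s * t) - log_sinhc (r * t)) / (s - r))"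

section \<open>Derivatives, bounds and monotonicity of \<open>log_sinhc\<close> and
  \<open>langevin\<close>\<close>

lemma langevin_0 [simp]: "langevin 0 = 0"
  by (simp add: langevin_def)

lemma log_sinhc_0 [simp]: "log_sinhc 0 = 0"
  by (simp add: log_sinhc_def)

lemma langevin_minus [simp]: "langevin (- u) = - langevin u"
  by (simp add: langevin_def)

lemma log_sinhc_minus [simp]: "log_sinhc (- u) = log_sinhc u"
  by (simp add: log_sinhc_def)

lemma sinhc_pos: "u \<noteq> 0 \<Longrightarrow> sinh u / u > 0" for u :: real
  by (cases "u > 0") (auto simp: divide_neg_neg)

lemma sinh_ge_self: "0 \<le> u \<Longrightarrow> u \<le> sinh u" for u :: real
proof -
  assume "0 \<le> u"
  have "sinh 0 - 0 \<le> sinh u - u"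
  proof (rule DERIV_nonneg_imp_nondecreasing[OF \<open>0 \<le> u\<close>])
    fix x :: real
    have "((\<lambda>x. sinh x - x) has_real_derivative cosh x - 1) (at x)"
      by (auto intro!: derivative_eq_intros)
    then show "\<exists>y. ((\<lambda>x. sinh x - x) has_real_derivative y) (at x) \<and> 0 \<le> y"
      using cosh_real_ge_1[of x] by force
  qed
  then show ?thesis by simp
qed

text \<open>Differentiability at \<open>0\<close> lets the mean value theorem be applied between
  parameters of opposite signs.\<close>

lemma DERIV_log_sinhc: "(log_sinhc has_real_derivative langevin u) (at u)"
proof (cases "u = 0")
  case True
  have "((\<lambda>h. ln (sinh h / h) / h) \<longlongrightarrow> (0::real)) (at 0)"
    by real_asymp
  then show ?thesis
    using True by (simp add: has_field_derivative_iff log_sinhc_def)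
next
  case False
  have "((\<lambda>u. ln (sinh u / u)) has_real_derivative langevin u) (at u)"
    using False sinhc_pos[OF False]
    by (auto intro!: derivative_eq_intros simp: langevin_def field_simps)
  then show ?thesis
    by (simp add: log_sinhc_def[abs_def])
qed

lemma DERIV_langevin:
  "u \<noteq> 0 \<Longrightarrow> (langevin has_real_derivative 1 / u\<^sup>2 - 1 / (sinh u)\<^sup>2) (at u)"
proof -
  assume u: "u \<noteq> 0"
  have "((\<lambda>u. cosh u / sinh u - 1 / u) has_real_derivative
      (sinh u * sinh u - cosh u * cosh u) / (sinh u * sinh u) + 1 / (u * u)) (at u)"
    using u by (auto intro!: derivative_eq_intros)
  moreover have "sinh u * sinh u - cosh u * cosh u = - 1"
    using cosh_square_eq[of u] by (simp add: power2_eq_square)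
  ultimately show ?thesis
    by (simp add: langevin_def[abs_def] power2_eq_square)
qed

lemma langevin_nonneg: "0 \<le> u \<Longrightarrow> 0 \<le> langevin u"
proof (cases "u = 0")
  case False
  assume "0 \<le> u"
  with False have u: "0 < u" by simp
  \<comment> \<open>Multiplying by \<open>u * sinh u\<close> turns the claim into
    \<open>sinh u \<le> u * cosh u\<close>.\<close>
  have "0 * cosh 0 - sinh 0 \<le> u * cosh u - sinh u"
  proof (rule DERIV_nonneg_imp_nondecreasing[OF \<open>0 \<le> u\<close>])
    fix x :: real
    assume "0 \<le> x"
    have "((\<lambda>x. x * cosh x - sinh x) has_real_derivative x * sinh x) (at x)"
      by (auto intro!: derivative_eq_intros)
    with \<open>0 \<le> x\<close> show "\<exists>y. ((\<lambda>x. x * cosh x - sinh x) has_real_derivative y) (at x) \<and> 0 \<le> y"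
      by (metis mult_nonneg_nonneg sinh_real_nonneg_iff)
  qed
  then show ?thesis
    using u by (simp add: langevin_def field_simps)
qed simp

lemma langevin_le_1: "langevin u \<le> 1"
proof (cases "u \<le> 0")
  case True
  then show ?thesis using langevin_nonneg[of "- u"] by simp
next
  case False
  then have u: "0 < u" by simp
  \<comment> \<open>Cleared of denominators, the claim reads
    \<open>u * (cosh u - sinh u) \<le> sinh u\<close>, and the bracket is
    \<open>exp (- u)\<close>.\<close>
  have "u * exp (- u) \<le> u * 1"
    using u by (intro mult_left_mono) auto
  also have "\<dots> \<le> sinh u" using sinh_ge_self[of u] u by simp
  finally have "u * (cosh u - sinh u) \<le> sinh u" by (simp add: cosh_minus_sinh)
  then show ?thesis
    using u by (simp add: langevin_def field_simps)
qed

text \<open>On the positive axis the derivative is nonnegative because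
  \<open>u \<le> sinh u\<close>. Oddness carries this to the negative axis, and the sign of
  \<open>langevin\<close> joins the two halves across \<open>0\<close>.\<close>

lemma mono_langevin: "mono langevin"
proof -
  have pos: "langevin u \<le> langevin v" if "0 < u" "u \<le> v" for u v
  proof (rule DERIV_nonneg_imp_nondecreasing[OF \<open>u \<le> v\<close>])
    fix x assume "u \<le> x"
    with that have x: "0 < x" by simp
    then have "x\<^sup>2 \<le> (sinh x)\<^sup>2"
      using sinh_ge_self[of x] by (intro power_mono) auto
    then have "0 \<le> 1 / x\<^sup>2 - 1 / (sinh x)\<^sup>2"
      using x by (simp add: frac_le)
    then show "\<exists>y. (langevin has_real_derivative y) (at x) \<and> 0 \<le> y"
      using DERIV_langevin[of x] x by blast
  qed
  show ?thesis
  proof (rule monoI)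
    fix u v :: real
    assume uv: "u \<le> v"
    consider "0 < u" | "u \<le> 0" "0 \<le> v" | "v < 0" by linarith
    then show "langevin u \<le> langevin v"
    proof cases
      case 1
      then show ?thesis using pos uv by blast
    next
      case 2
      then show ?thesis using langevin_nonneg[of "- u"] langevin_nonneg[of v] by simp
    next
      case 3
      then show ?thesis using pos[of "- v" "- u"] uv by simp
    qed
  qed
qed

section \<open>The exponent of a Stolarsky mean\<close>

lemma stolarsky_exponent_minus [simp]: "stolarsky_exponent r s (- t) = stolarsky_exponent r s t"
  by (simp add: stolarsky_exponent_def)

lemma stolarsky_exponent_0 [simp]: "stolarsky_exponent r s 0 = 0"
  by (simp add: stolarsky_exponent_def)

lemma stolarsky_exponent_commute: "stolarsky_exponent r s t = stolarsky_exponent s r t"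
  using minus_divide_divide[of "log_sinhc (s * t) - log_sinhc (r * t)" "s - r"]
  by (simp add: stolarsky_exponent_def)

lemma stolarsky_exponent_mean_value_le:
  assumes "r \<le> s"
  shows "\<exists>\<xi>. r \<le> \<xi> \<and> \<xi> \<le> s \<and> stolarsky_exponent r s t = t * langevin (\<xi> * t)"
proof (cases "r = s")
  case True
  then show ?thesis by (auto simp: stolarsky_exponent_def)
next
  case False
  with assms have "r < s" by simp
  have "((\<lambda>p. log_sinhc (p * t)) has_real_derivative langevin (p * t) * t) (at p)" for p
    by (rule DERIV_chain2[OF DERIV_log_sinhc]) (auto intro!: derivative_eq_intros)
  from MVT2[OF \<open>r < s\<close> this] obtain \<xi> where
    "r < \<xi>" "\<xi> < s" "log_sinhc (s * t) - log_sinhc (r * t) = (s - r) * (langevin (\<xi> * t) * t)"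
    by blast
  then show ?thesis
    using \<open>r < s\<close> by (intro exI[of _ \<xi>]) (simp add: stolarsky_exponent_def)
qed

lemma stolarsky_exponent_mean_value:
  "\<exists>\<xi>. min r s \<le> \<xi> \<and> \<xi> \<le> max r s \<and> stolarsky_exponent r s t = t * langevin (\<xi> * t)"
  using stolarsky_exponent_mean_value_le[of r s t] stolarsky_exponent_mean_value_le[of s r t]
  by (cases "r \<le> s") (auto simp: stolarsky_exponent_commute[of s r])

text \<open>The outer factor \<open>t\<close> makes the direction independent of the sign of
  \<open>t\<close>: a negative \<open>t\<close> reverses the order twice.\<close>

lemma mult_langevin_mono:
  assumes "p \<le> q"
  shows "t * langevin (p * t) \<le> t * langevin (q * t)"
proof (cases "0 \<le> t")
  case True
  with assms show ?thesis
    by (intro mult_left_mono monoD[OF mono_langevin] mult_right_mono)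
next
  case False
  with assms show ?thesis
    by (intro mult_left_mono_neg monoD[OF mono_langevin] mult_right_mono_neg) auto
qed

text \<open>Squeezes an arbitrary exponent between diagonal ones, to which all later estimates are
  thereby reduced.\<close>

lemma stolarsky_exponent_bounds:
  assumes "p \<le> r" "p \<le> s" "r \<le> q" "s \<le> q"
  shows "t * langevin (p * t) \<le> stolarsky_exponent r s t"
    and "stolarsky_exponent r s t \<le> t * langevin (q * t)"
proof -
  obtain \<xi> where "min r s \<le> \<xi>" "\<xi> \<le> max r s" "stolarsky_exponent r s t = t * langevin (\<xi> * t)"
    using stolarsky_exponent_mean_value by blast
  then show "t * langevin (p * t) \<le> stolarsky_exponent r s t"
    and "stolarsky_exponent r s t \<le> t * langevin (q * t)"
    using assms by (auto intro!: mult_langevin_mono)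
qed

lemma abs_stolarsky_exponent_le: "\<bar>stolarsky_exponent r s t\<bar> \<le> \<bar>t\<bar>"
proof -
  obtain \<xi> where "stolarsky_exponent r s t = t * langevin (\<xi> * t)"
    using stolarsky_exponent_mean_value by blast
  moreover have "\<bar>langevin (\<xi> * t)\<bar> \<le> 1"
    using langevin_le_1[of "\<xi> * t"] langevin_le_1[of "- (\<xi> * t)"] unfolding langevin_minus by linarith
  ultimately show ?thesis
    by (simp add: abs_mult mult_left_le)
qed

section \<open>The means in exponential coordinates\<close>

text \<open>Here \<open>g\<close> is the geometric mean and \<open>t\<close> half of
  \<open>ln (a / b)\<close>. Swapping \<open>a\<close> and \<open>b\<close> negates
  \<open>t\<close>; scaling both changes only \<open>g\<close>.\<close>

lemma pos_pair_exp_coordinates: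
  assumes "a > 0" "b > 0"
  obtains g t :: real where "g > 0" "a = g * exp t" "b = g * exp (- t)"
proof
  show "exp ((ln a + ln b) / 2) > 0" by simp
  show "a = exp ((ln a + ln b) / 2) * exp ((ln a - ln b) / 2)"
    and "b = exp ((ln a + ln b) / 2) * exp (- ((ln a - ln b) / 2))"
    using assms by (simp_all add: add_divide_distrib diff_divide_distrib flip: exp_add)
qed

text \<open>Differences and sums of \<open>p\<close>-th powers become \<open>sinh (p * t)\<close>
  and \<open>cosh (p * t)\<close> times \<open>2 * g powr p\<close>; in each branch the powers of
  \<open>g\<close> then collapse to a single factor \<open>g\<close>.\<close>

lemma stolarsky_exp:
  assumes g: "g > 0"
  shows "stolarsky r s (g * exp t) (g * exp (- t)) = g * exp (stolarsky_exponent r s t)"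
proof (cases "t = 0")
  case True
  then show ?thesis by (simp add: stolarsky_def)
next
  case t: False
  define x y where "x = g * exp t" and "y = g * exp (- t)"
  have xy: "x > 0" "y > 0" "x \<noteq> y"
    using g t by (auto simp: x_def y_def)
  have lnx: "ln x = ln g + t" and lny: "ln y = ln g - t"
    using g by (simp_all add: x_def y_def ln_mult)
  have powr_xy: "x powr p = g powr p * exp (p * t)" "y powr p = g powr p * exp (- (p * t))" for p
    using g xy by (simp_all add: powr_def lnx lny distrib_left right_diff_distrib flip: exp_add)
  have powr_diff: "x powr p - y powr p = 2 * g powr p * sinh (p * t)" for p
    unfolding powr_xy sinh_def by (simp add: algebra_simps)
  have powr_sum: "x powr p + y powr p = 2 * g powr p * cosh (p * t)" for p
    unfolding powr_xy cosh_def by (simp add: algebra_simps)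
  \<comment> \<open>Shared by the two branches in which exactly one parameter is zero.\<close>
  have log_mean: "((x powr p - y powr p) / (p * (ln x - ln y))) powr (1 / p)
      = g * exp (log_sinhc (p * t) / p)" if "p \<noteq> 0" for p
  proof -
    have pos: "sinh (p * t) / (p * t) > 0" using that t by (intro sinhc_pos) simp
    have eq: "(x powr p - y powr p) / (p * (ln x - ln y)) = g powr p * (sinh (p * t) / (p * t))"
      unfolding powr_diff lnx lny using that t by (simp add: field_simps)
    show ?thesis
      unfolding eq log_sinhc_def using g pos that
      by (subst powr_mult) (auto simp: powr_powr powr_def[of "sinh (p * t) / (p * t)"])
  qed
  consider "r = s" "s = 0" | "r = s" "s \<noteq> 0" | "r \<noteq> s" "r = 0" | "r \<noteq> s" "s = 0"
    | "r \<noteq> s" "r \<noteq> 0" "s \<noteq> 0" by blast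
  then have "stolarsky r s x y = g * exp (stolarsky_exponent r s t)"
  proof cases
    case 1
    have "sqrt (x * y) = g"
      using g by (intro real_sqrt_unique)
        (simp_all add: x_def y_def exp_minus power2_eq_square)
    with 1 show ?thesis
      using xy by (simp add: stolarsky_def stolarsky_exponent_def)
  next
    case 2
    \<comment> \<open>Separating \<open>ln g\<close> from \<open>t\<close> leaves the ratio of sum
      to difference, which is the hyperbolic cotangent; the remaining \<open>- (1 / s)\<close> is
      the \<open>- 1 / u\<close> term of \<open>langevin\<close>, scaled by
      \<open>t\<close>.\<close>
    have "x powr s * ln x - y powr s * ln y
        = ln g * (x powr s - y powr s) + t * (x powr s + y powr s)"
      by (simp add: lnx lny algebra_simps)
    then have "(x powr s * ln x - y powr s * ln y) / (x powr s - y powr s)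
        = ln g + t * (cosh (s * t) / sinh (s * t))"
      unfolding powr_diff powr_sum using g t 2 by (simp add: field_simps)
    then have "stolarsky r s x y = exp (ln g + t * langevin (s * t))"
      using 2 xy t by (simp add: stolarsky_def langevin_def algebra_simps)
    then show ?thesis using g 2 by (simp add: exp_add stolarsky_exponent_def)
  next
    case 3
    then show ?thesis using xy log_mean[of s] by (simp add: stolarsky_def stolarsky_exponent_def)
  next
    case 4
    then show ?thesis using xy log_mean[of r]
      by (simp add: stolarsky_def stolarsky_exponent_def)
  next
    case 5
    have pos: "sinh (s * t) / (s * t) > 0" "sinh (r * t) / (r * t) > 0"
      using 5 t by (simp_all only: sinhc_pos mult_eq_0_iff simp_thms)
    have quotient_powr: "(A / B) powr (1 / c) = exp ((ln A - ln B) / c)"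
      if "A > 0" "B > 0" for A B c :: real
      using that by (simp add: powr_def ln_div)
    have eq: "r * (x powr s - y powr s) / (s * (x powr r - y powr r))
        = g powr (s - r) * (sinh (s * t) / (s * t) / (sinh (r * t) / (r * t)))"
      unfolding powr_diff powr_diff using 5 t g by (simp add: field_simps Transcendental.powr_diff)
    have "(sinh (s * t) / (s * t) / (sinh (r * t) / (r * t))) powr (1 / (s - r))
        = exp ((log_sinhc (s * t) - log_sinhc (r * t)) / (s - r))"
      unfolding log_sinhc_def by (rule quotient_powr[OF pos])
    moreover have "(g powr (s - r)) powr (1 / (s - r)) = g"
      using g 5 by (simp add: powr_powr)
    ultimately have "(r * (x powr s - y powr s) / (s * (x powr r - y powr r))) powr (1 / (s - r))
        = g * exp ((log_sinhc (s * t) - log_sinhc (r * t)) / (s - r))"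
      unfolding eq by (simp only: powr_mult)
    then show ?thesis
      using 5 xy by (simp add: stolarsky_def stolarsky_exponent_def)
  qed
  then show ?thesis by (simp add: x_def y_def)
qed

lemma stolarsky_diag_exp:
  "g > 0 \<Longrightarrow> stolarsky s s (g * exp t) (g * exp (- t)) = g * exp (t * langevin (s * t))"
  by (simp add: stolarsky_exp stolarsky_exponent_def)

text \<open>The two weights have sum \<open>1\<close> and difference \<open>tanh t\<close>, so the
  weighted mean of \<open>ln g + t\<close> and \<open>ln g - t\<close> is
  \<open>ln g + t * tanh t\<close>.\<close>

lemma upper_mean_exp:
  assumes "g > 0"
  shows "upper_mean (g * exp t) (g * exp (- t)) = g * exp (t * tanh t)"
proof -
  have s: "exp t + exp (- t) > 0" by (simp add: add_pos_pos)
  have "g * exp t / (g * exp t + g * exp (- t)) = exp t / (exp t + exp (- t))"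
    "g * exp (- t) / (g * exp t + g * exp (- t)) = exp (- t) / (exp t + exp (- t))"
    using assms by (simp_all flip: distrib_left)
  moreover have "exp t / (exp t + exp (- t)) + exp (- t) / (exp t + exp (- t)) = 1"
    using s by (simp flip: add_divide_distrib)
  moreover have "tanh t = exp t / (exp t + exp (- t)) - exp (- t) / (exp t + exp (- t))"
    by (simp add: tanh_def sinh_def cosh_def diff_divide_distrib)
  ultimately obtain u v where uv: "g * exp t / (g * exp t + g * exp (- t)) = u"
    "g * exp (- t) / (g * exp t + g * exp (- t)) = v" "u + v = 1" "tanh t = u - v"
    by metis
  have "upper_mean (g * exp t) (g * exp (- t)) = g powr (u + v) * exp (t * (u - v))"
    unfolding upper_mean_def uv(1,2) using assms
    by (simp add: powr_def ln_mult algebra_simps flip: exp_add)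
  then show ?thesis using uv assms by simp
qed

text \<open>The product of the lower and upper means is \<open>a * b\<close>, the square of
  \<open>g\<close>, so the exponents are opposite.\<close>

lemma lower_mean_exp:
  assumes "g > 0"
  shows "lower_mean (g * exp t) (g * exp (- t)) = g * exp (- (t * tanh t))"
proof -
  define a b where "a = g * exp t" and "b = g * exp (- t)"
  have ab: "a > 0" "b > 0" using assms by (simp_all add: a_def b_def)
  have "lower_mean a b * upper_mean a b = a powr (b / (a+b) + a / (a+b)) * b powr (a / (a+b) + b / (a+b))"
    unfolding lower_mean_def upper_mean_def powr_add by (simp add: ac_simps)
  also have "\<dots> = a * b"
    using ab by (simp add: add_divide_distrib[symmetric] add.commute)
  also have "\<dots> = g * g" by (simp add: a_def b_def exp_minus)
  finally have "lower_mean a b * (g * exp (t * tanh t)) = g * g"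
    unfolding a_def b_def upper_mean_exp[OF assms] .
  then show ?thesis
    using assms by (simp add: a_def b_def exp_minus field_simps)
qed

section \<open>The inequality behind the constant 3\<close>

text \<open>This is the hyperbolic Huygens inequality. With \<open>c = cosh x\<close>, the
  derivative of the difference is \<open>2 * c + 1 / c\<^sup>2 - 3\<close>, which is nonnegative
  because its numerator has the double root \<open>c = 1\<close>.\<close>

lemma two_sinh_plus_tanh_ge: "0 \<le> v \<Longrightarrow> 3 * v \<le> 2 * sinh v + tanh v" for v :: real
proof -
  assume "0 \<le> v"
  have "2 * sinh 0 + tanh 0 - 3 * 0 \<le> 2 * sinh v + tanh v - 3 * v"
  proof (rule DERIV_nonneg_imp_nondecreasing[OF \<open>0 \<le> v\<close>])
    fix x :: real
    define c where "c = cosh x"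
    have c: "c \<ge> 1" by (simp add: c_def cosh_real_ge_1)
    have "((\<lambda>x. 2 * sinh x + tanh x - 3 * x) has_real_derivative
        2 * cosh x + (1 - tanh x ^ 2) - 3) (at x)"
      by (auto intro!: derivative_eq_intros)
    moreover have "1 - tanh x ^ 2 = 1 / c\<^sup>2"
      using sinh_square_eq[of x] c unfolding tanh_def power_divide c_def[symmetric]
      by (simp add: diff_divide_distrib)
    moreover have "2 * c + 1 / c\<^sup>2 - 3 = (c - 1)\<^sup>2 * (2 * c + 1) / c\<^sup>2"
      using c by (simp add: field_simps power2_eq_square)
    moreover have "(c - 1)\<^sup>2 * (2 * c + 1) / c\<^sup>2 \<ge> 0" using c by simp
    ultimately show "\<exists>y. ((\<lambda>x. 2 * sinh x + tanh x - 3 * x) has_real_derivative y) (at x) \<and> 0 \<le> y"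
      by (intro exI[of _ "2 * cosh x + (1 - tanh x ^ 2) - 3"]) (simp add: c_def)
  qed
  then show ?thesis by simp
qed

text \<open>The difference of \<open>cosh (3 * t) / sinh (3 * t)\<close> and \<open>tanh t\<close>
  is a single fraction with numerator \<open>cosh (2 * t)\<close>. The denominator is bounded by
  writing the product as a sum and applying the previous inequality at \<open>2 * t\<close>.\<close>

lemma langevin_3_le_tanh: "0 \<le> t \<Longrightarrow> langevin (3 * t) \<le> tanh t"
proof (cases "t = 0")
  case False
  assume "0 \<le> t"
  with False have t: "0 < t" by simp
  have pos: "sinh (3 * t) > 0" "cosh t > 0" "cosh (2 * t) > 0" using t by simp_all
  have "cosh (3 * t) * cosh t - sinh (3 * t) * sinh t = cosh (2 * t)"
    using cosh_diff[of "3 * t" t] by simp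
  then have diff: "cosh (3 * t) / sinh (3 * t) - tanh t = cosh (2 * t) / (sinh (3 * t) * cosh t)"
    using pos by (simp add: tanh_def field_simps)
  have "2 * (sinh (3 * t) * cosh t) = sinh (4 * t) + sinh (2 * t)"
    using sinh_add[of "3 * t" t] sinh_diff[of "3 * t" t] by simp
  also have "sinh (4 * t) = 2 * sinh (2 * t) * cosh (2 * t)"
    using sinh_double[of "2 * t"] by simp
  also have "2 * sinh (2 * t) * cosh (2 * t) + sinh (2 * t)
      = (2 * sinh (2 * t) + tanh (2 * t)) * cosh (2 * t)"
    using pos by (simp add: tanh_def field_simps)
  also have "\<dots> \<ge> 3 * (2 * t) * cosh (2 * t)"
    using two_sinh_plus_tanh_ge[of "2 * t"] pos t by (intro mult_right_mono) auto
  finally have "3 * t * cosh (2 * t) \<le> sinh (3 * t) * cosh t" by (simp add: ac_simps)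
  then have "cosh (2 * t) / (sinh (3 * t) * cosh t) \<le> 1 / (3 * t)"
    using pos t by (simp add: field_simps)
  then show ?thesis using diff by (simp add: langevin_def)
qed simp

lemma mult_langevin_3_le: "t * langevin (3 * t) \<le> t * tanh t"
proof (cases "0 \<le> t")
  case True
  then show ?thesis by (intro mult_left_mono langevin_3_le_tanh)
next
  case False
  then show ?thesis using langevin_3_le_tanh[of "- t"] by (intro mult_left_mono_neg) auto
qed

section \<open>Asymptotics at zero and at infinity\<close>

lemma langevin_le_tanh_imp_le_3:
  assumes "\<And>t. t > 0 \<Longrightarrow> langevin (s * t) \<le> tanh t"
  shows "s \<le> 3"
proof (cases "s > 0")
  case s: True
  \<comment> \<open>The substitution \<open>u = s * t\<close> keeps \<open>s\<close> out of the
    \<open>langevin\<close> limit; comparing the limits gives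
    \<open>1 / 3 \<le> 1 / s\<close>.\<close>
  have "((\<lambda>u. (cosh u / sinh u - 1 / u) / u) \<longlongrightarrow> (1 / 3 :: real)) (at_right 0)"
    by real_asymp
  moreover have "((\<lambda>u. tanh (u / s) / u) \<longlongrightarrow> inverse s) (at_right 0)"
    unfolding tanh_def using s by real_asymp
  moreover have "(cosh u / sinh u - 1 / u) / u \<le> tanh (u / s) / u" if "u > 0" for u
    using assms[of "u / s"] s that by (simp add: langevin_def divide_right_mono)
  then have "eventually (\<lambda>u. (cosh u / sinh u - 1 / u) / u \<le> tanh (u / s) / u) (at_right 0)"
    by (auto simp: eventually_at_right_field intro!: exI[of _ 1])
  ultimately have "1 / 3 \<le> inverse s"
    by (intro tendsto_le[of "at_right 0"]) auto
  then show ?thesis using s by (simp add: field_simps)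
qed simp

lemma exists_mult_langevin_less_tanh:
  "\<exists>t. t * langevin (q * t) < t * tanh t"
proof -
  \<comment> \<open>Enlarging \<open>q\<close> only strengthens the claim by monotonicity, and
    \<open>p > 0\<close> makes the limit \<open>1 / p\<close> positive.\<close>
  define p where "p = max q 1"
  have p: "p > 0" "q \<le> p" by (auto simp: p_def)
  have "((\<lambda>t. t * tanh t - t * langevin (p * t)) \<longlongrightarrow> inverse p) at_top"
    unfolding tanh_def langevin_def using p by real_asymp
  then have "eventually (\<lambda>t. t * tanh t - t * langevin (p * t) > 0) at_top"
    by (rule order_tendstoD(1)) (use p in simp)
  then obtain t where "t * tanh t - t * langevin (p * t) > 0"
    by (meson eventually_happens' trivial_limit_at_top_linorder)
  then show ?thesis
    using mult_langevin_mono[OF p(2), of t] by (intro exI[of _ t]) linarith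
qed

section \<open>Transfer from exponents to means\<close>

text \<open>Minimum and maximum of the arguments are \<open>g\<close> times the exponentials of
  \<open>-\<bar>t\<bar>\<close> and \<open>\<bar>t\<bar>\<close>, so the mean property is a bound on
  the exponent.\<close>

lemma is_meanI_exp:
  assumes "\<And>g t. g > 0 \<Longrightarrow> M (g * exp t) (g * exp (- t)) = g * exp (d t)"
    and "\<And>t. \<bar>d t\<bar> \<le> \<bar>t\<bar>"
  shows "is_mean M"
  unfolding is_mean_def
proof (intro allI impI)
  fix a b :: real
  assume "a > 0" "b > 0"
  then obtain g t where gt: "g > 0" "a = g * exp t" "b = g * exp (- t)"
    by (rule pos_pair_exp_coordinates)
  then show "min a b \<le> M a b \<and> M a b \<le> max a b"
    using assms(2)[of t] by (cases "t \<ge> 0") (auto simp: assms(1) min_le_iff_disj le_max_iff_disj)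
qed

lemma stolarsky_in_Omega_means: "stolarsky r s \<in> Omega_means"
proof -
  have "is_mean (stolarsky r s)"
    by (rule is_meanI_exp[OF stolarsky_exp abs_stolarsky_exponent_le])
  moreover have "stolarsky r s a b = stolarsky r s b a" if ab: "a > 0" "b > 0" for a b
  proof -
    obtain g t where "g > 0" "a = g * exp t" "b = g * exp (- t)"
      by (rule pos_pair_exp_coordinates[OF ab])
    then show ?thesis using stolarsky_exp[of g r s t] stolarsky_exp[of g r s "- t"] by simp
  qed
  moreover have "stolarsky r s a a = a" for a by (simp add: stolarsky_def)
  moreover have "stolarsky r s (l * a) (l * b) = l * stolarsky r s a b"
    if lab: "l > 0" "a > 0" "b > 0" for l a b
  proof -
    obtain g t where "g > 0" "a = g * exp t" "b = g * exp (- t)"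
      by (rule pos_pair_exp_coordinates[OF lab(2,3)])
    then show ?thesis
      using stolarsky_exp[of g r s t] stolarsky_exp[of "l * g" r s t] lab
      by (simp add: mult.assoc)
  qed
  ultimately show ?thesis by (simp add: Omega_means_def)
qed

lemma abs_mult_tanh_le: "\<bar>t * tanh t\<bar> \<le> \<bar>t\<bar>" for t :: real
  using tanh_real_lt_1[of t] tanh_real_gt_neg1[of t] by (simp add: abs_mult mult_left_le)

lemma is_mean_upper_mean: "is_mean upper_mean"
  by (rule is_meanI_exp[OF upper_mean_exp abs_mult_tanh_le])

lemma is_mean_lower_mean: "is_mean lower_mean"
  by (rule is_meanI_exp[OF lower_mean_exp]) (simp_all add: abs_mult_tanh_le)

lemma stolarsky_3_le_upper_mean:
  assumes "a > 0" "b > 0"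
  shows "stolarsky 3 3 a b \<le> upper_mean a b"
proof -
  obtain g t where "g > 0" "a = g * exp t" "b = g * exp (- t)"
    using assms by (rule pos_pair_exp_coordinates)
  then show ?thesis using mult_langevin_3_le[of t] by (simp add: stolarsky_diag_exp upper_mean_exp)
qed

lemma lower_mean_le_stolarsky_minus_3:
  assumes "a > 0" "b > 0"
  shows "lower_mean a b \<le> stolarsky (-3) (-3) a b"
proof -
  obtain g t where "g > 0" "a = g * exp t" "b = g * exp (- t)"
    using assms by (rule pos_pair_exp_coordinates)
  then show ?thesis using mult_langevin_3_le[of t] by (simp add: stolarsky_diag_exp lower_mean_exp)
qed

lemma stolarsky_bounds:
  assumes "p \<le> r" "p \<le> s" "r \<le> q" "s \<le> q" "a > 0" "b > 0"
  shows "stolarsky p p a b \<le> stolarsky r s a b" and "stolarsky r s a b \<le> stolarsky q q a b"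
proof -
  obtain g t where "g > 0" "a = g * exp t" "b = g * exp (- t)"
    using assms(5,6) by (rule pos_pair_exp_coordinates)
  then show "stolarsky p p a b \<le> stolarsky r s a b" "stolarsky r s a b \<le> stolarsky q q a b"
    using stolarsky_exponent_bounds[OF assms(1-4), of t]
    \<comment> \<open>The diagonal means are rewritten first, since \<open>stolarsky_exp\<close>
      matches them too and would hide the \<open>langevin\<close> form of the bounds.\<close>
    by (simp_all only: stolarsky_diag_exp) (simp_all add: stolarsky_exp)
qed

lemma stolarsky_le_upper_mean_imp_le_3:
  assumes "\<forall>a>0. \<forall>b>0. stolarsky s s a b \<le> upper_mean a b"
  shows "s \<le> 3"
proof (rule langevin_le_tanh_imp_le_3)
  fix t :: real
  assume "t > 0"
  then show "langevin (s * t) \<le> tanh t"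
    \<comment> \<open>By homogeneity \<open>g = 1\<close> loses nothing; the factor \<open>1\<close>
      is kept so that the coordinate formulas match.\<close>
    using assms[rule_format, of "1 * exp t" "1 * exp (- t)"]
    unfolding stolarsky_diag_exp[OF zero_less_one] upper_mean_exp[OF zero_less_one] by simp
qed

lemma lower_mean_le_stolarsky_imp_ge:
  assumes "\<forall>a>0. \<forall>b>0. lower_mean a b \<le> stolarsky s s a b"
  shows "-3 \<le> s"
proof -
  \<comment> \<open>As \<open>langevin\<close> is odd, a lower bound with parameter \<open>s\<close>
    is an upper bound with parameter \<open>- s\<close>.\<close>
  have "- s \<le> 3"
  proof (rule langevin_le_tanh_imp_le_3)
    fix t :: real
    assume "t > 0"
    then have "t * (- tanh t) \<le> t * langevin (s * t)"
      using assms[rule_format, of "1 * exp t" "1 * exp (- t)"]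
      unfolding stolarsky_diag_exp[OF zero_less_one] lower_mean_exp[OF zero_less_one] by simp
    with \<open>t > 0\<close> show "langevin (- s * t) \<le> tanh t" by (simp add: mult_le_cancel_left_pos del: mult_minus_right)
  qed
  then show ?thesis by simp
qed

section \<open>The cancelling property\<close>

lemma not_upper_mean_le_stolarsky: "\<not> mean_le upper_mean (stolarsky r s)"
proof
  assume le: "mean_le upper_mean (stolarsky r s)"
  \<comment> \<open>The diagonal exponent at \<open>max r s\<close> dominates the one at
    \<open>r\<close> and \<open>s\<close>, so a point where it falls below \<open>t * tanh t\<close>
    suffices.\<close>
  obtain t where t: "t * langevin (max r s * t) < t * tanh t"
    using exists_mult_langevin_less_tanh by blast
  have "upper_mean (1 * exp t) (1 * exp (- t)) \<le> stolarsky r s (1 * exp t) (1 * exp (- t))"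
    using le by (simp add: mean_le_def)
  then have "t * tanh t \<le> stolarsky_exponent r s t"
    unfolding upper_mean_exp[OF zero_less_one] stolarsky_exp[OF zero_less_one] by simp
  also have "\<dots> \<le> t * langevin (max r s * t)"
    by (rule stolarsky_exponent_bounds(2)[of "min r s"]) auto
  finally show False using t by simp
qed

lemma not_stolarsky_le_lower_mean: "\<not> mean_le (stolarsky r s) lower_mean"
proof
  assume le: "mean_le (stolarsky r s) lower_mean"
  \<comment> \<open>Oddness turns the lower diagonal exponent at \<open>min r s\<close> into the
    negative of the one at \<open>- min r s\<close>.\<close>
  obtain t where t: "t * langevin (- min r s * t) < t * tanh t"
    using exists_mult_langevin_less_tanh by blast
  have "stolarsky r s (1 * exp t) (1 * exp (- t)) \<le> lower_mean (1 * exp t) (1 * exp (- t))"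
    using le by (simp add: mean_le_def)
  then have "stolarsky_exponent r s t \<le> - (t * tanh t)"
    unfolding lower_mean_exp[OF zero_less_one] stolarsky_exp[OF zero_less_one] by simp
  moreover have "t * langevin (min r s * t) \<le> stolarsky_exponent r s t"
    by (rule stolarsky_exponent_bounds(1)[of _ _ _ "max r s"]) auto
  ultimately show False using t by simp
qed

lemma left_cancelling_lower_mean: "left_cancelling_mean stolarsky_class lower_mean"
  unfolding left_cancelling_mean_def
proof (intro conjI)
  show "\<exists>M\<in>stolarsky_class. mean_le lower_mean M"
    using lower_mean_le_stolarsky_minus_3
    by (intro bexI[of _ "stolarsky (-3) (-3)"]) (auto simp: mean_le_def stolarsky_class_def)
qed (auto simp: stolarsky_class_def stolarsky_in_Omega_means is_mean_lower_mean
    not_stolarsky_le_lower_mean)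

lemma right_cancelling_upper_mean: "right_cancelling_mean stolarsky_class upper_mean"
  unfolding right_cancelling_mean_def
proof (intro conjI)
  show "\<exists>M\<in>stolarsky_class. mean_le M upper_mean"
    using stolarsky_3_le_upper_mean
    by (intro bexI[of _ "stolarsky 3 3"]) (auto simp: mean_le_def stolarsky_class_def)
qed (auto simp: stolarsky_class_def stolarsky_in_Omega_means is_mean_upper_mean
    not_upper_mean_le_stolarsky)

theorem theorem3p2:
  "(\<forall>r s a b :: real. -3 \<le> r \<and> r \<le> s \<and> s \<le> 3 \<and> a > 0 \<and> b > 0 \<longrightarrow>
      lower_mean a b \<le> stolarsky (-3) (-3) a b \<and>
      stolarsky (-3) (-3) a b \<le> stolarsky r s a b \<and>
      stolarsky r s a b \<le> stolarsky 3 3 a b \<and>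
      stolarsky 3 3 a b \<le> upper_mean a b) \<and>
   left_cancelling_mean stolarsky_class lower_mean \<and>
   right_cancelling_mean stolarsky_class upper_mean \<and>
   (\<forall>a>0. \<forall>b>0. stolarsky 3 3 a b \<le> upper_mean a b) \<and>
   (\<forall>s :: real. (\<forall>a>0. \<forall>b>0. stolarsky s s a b \<le> upper_mean a b) \<longrightarrow> s \<le> 3) \<and>
   (\<forall>a>0. \<forall>b>0. lower_mean a b \<le> stolarsky (-3) (-3) a b) \<and>
   (\<forall>s :: real. (\<forall>a>0. \<forall>b>0. lower_mean a b \<le> stolarsky s s a b) \<longrightarrow> -3 \<le> s)"
  using lower_mean_le_stolarsky_minus_3 stolarsky_3_le_upper_mean
    left_cancelling_lower_mean right_cancelling_upper_mean
    stolarsky_le_upper_mean_imp_le_3 lower_mean_le_stolarsky_imp_ge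
    stolarsky_bounds[of "-3" _ _ 3]
  by (intro conjI allI impI) auto

end
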